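(* Let $\mathbf Y_0=\{\mathbf Y_0(u):u\in\mathbb S^d\}$ be a mean-zero Gaussian random field on $\mathbb S^d$ with multiquadric covariance function, i.e. there exist $(\sigma,\delta,\tau)\in(0,\infty)\times(0,1)\times(0,\infty)$ such that for all $u,v\in\mathbb S^d$, $$\mathbb E[\mathbf Y_0(u)\mathbf Y_0(v)]=\sigma^{2}\left(\frac{(1-\delta)^{2}}{1+\delta^{2}-2\delta \cos r}\right)^{\tau},\qquad r=d(u,v)\in[0,\pi].$$ Then $\mathbf Y_0$ is (almost surely) locally sample Hölder continuous of any order $k\in(0,1)$.
   Context: Let $d\ge 1$ be an integer. $\mathbb S^d=\{x\in\mathbb R^{d+1}:\|x\|=1\}$ is the $d$-dimensional unit sphere, and $d(u,v)=\arccos(\langle u,v\rangle)$ is the geodesic distance between $u,v\in\mathbb S^d$, where $\langle\cdot,\cdot\rangle$ is the usual inner product on $\mathbb R^{d+1}$ (the symbol $d$ without arguments is the dimension). A Gaussian random field on $\mathbb S^d$ is a random field $\{\mathbf Y(u):u\in\mathbb S^d\}$ such that $\sum_{i=1}^n a_i\mathbf Y(u_i)$ is normally distributed for any integer $n>0$, real numbers $a_1,\dots,a_n$ and points $u_1,\dots,u_n\in\mathbb S^d$. It is mean-zero if $\mathbb E[\mathbf Y(u)]=0$ for all $u\in\mathbb S^d$. A random field $\mathbf Y_0$ on $\mathbb S^d$ is almost surely locally sample Hölder continuous of order $k>0$ if, with probability one, for every $s\in\mathbb S^d$ there are a neighbourhood $V$ of $s$ and a constant $C_{V,k}$ such that $$\sup_{u,v\in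 V,\,u\ne v}\left|\frac{\mathbf Y_0(u)-\mathbf Y_0(v)}{d(u,v)^k}\right|\le C_{V,k}.$$
   Formalization: As stated this fails for arbitrary fields (add the indicator of u=U, U an independent uniform point). The formal theorem shows that the field has a modification that is a.s. locally Hölder of every order k in (0,1), and that the field itself is so when it is separable in Doob's sense. *)

theory Defs
  imports "HOL-Probability.Probability"
begin

abbreviation unit_sphere :: "(real ^ 'n) set" where
  "unit_sphere \<equiv> sphere 0 1"

definition geodesic_dist :: "real ^ 'n \<Rightarrow> real ^ 'n \<Rightarrow> real" where
  "geodesic_dist u v = arccos (u \<bullet> v)"

(* Variance 0 (a point mass) counts as normal: the zero linear combination must be allowed. *)
definition normally_distributed :: "'w measure \<Rightarrow> ('w \<Rightarrow> real) \<Rightarrow> bool" where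
  "normally_distributed M X \<longleftrightarrow>
     X \<in> borel_measurable M \<and>
     ((\<exists>m. distr M borel X = return borel m) \<or>
      (\<exists>m s. s > 0 \<and> distributed M lborel X (normal_density m s)))"

definition random_field_on :: "'t set \<Rightarrow> 'w measure \<Rightarrow> ('t \<Rightarrow> 'w \<Rightarrow> real) \<Rightarrow> bool" where
  "random_field_on T M Y \<longleftrightarrow> prob_space M \<and> (\<forall>u\<in>T. Y u \<in> borel_measurable M)"

definition gaussian_field_on :: "'t set \<Rightarrow> 'w measure \<Rightarrow> ('t \<Rightarrow> 'w \<Rightarrow> real) \<Rightarrow> bool" where
  "gaussian_field_on T M Y \<longleftrightarrow> random_field_on T M Y \<and>
     (\<forall>(n::nat) (a :: nat \<Rightarrow> real) (u :: nat \<Rightarrow> 't). n > 0 \<longrightarrow> (\<forall>i<n. u i \<in> T) \<longrightarrow>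
        normally_distributed M (\<lambda>\<omega>. \<Sum>i<n. a i * Y (u i) \<omega>))"

definition mean_zero_on :: "'t set \<Rightarrow> 'w measure \<Rightarrow> ('t \<Rightarrow> 'w \<Rightarrow> real) \<Rightarrow> bool" where
  "mean_zero_on T M Y \<longleftrightarrow> (\<forall>u\<in>T. integral\<^sup>L M (Y u) = 0)"

definition multiquadric :: "real \<Rightarrow> real \<Rightarrow> real \<Rightarrow> real \<Rightarrow> real" where
  "multiquadric \<sigma> \<delta> \<tau> r =
     \<sigma>\<^sup>2 * (((1 - \<delta>)\<^sup>2 / (1 + \<delta>\<^sup>2 - 2 * \<delta> * cos r)) powr \<tau>)"

definition has_multiquadric_covariance :: "'w measure \<Rightarrow> (real ^ 'n \<Rightarrow> 'w \<Rightarrow> real) \<Rightarrow> bool" where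
  "has_multiquadric_covariance M Y \<longleftrightarrow>
     (\<exists>\<sigma> \<delta> \<tau>. 0 < \<sigma> \<and> 0 < \<delta> \<and> \<delta> < 1 \<and> 0 < \<tau> \<and>
        (\<forall>u\<in>unit_sphere. \<forall>v\<in>unit_sphere.
           (\<integral>\<omega>. Y u \<omega> * Y v \<omega> \<partial>M) = multiquadric \<sigma> \<delta> \<tau> (geodesic_dist u v)))"

definition as_locally_sample_holder ::
    "'w measure \<Rightarrow> (real ^ 'n \<Rightarrow> 'w \<Rightarrow> real) \<Rightarrow> real \<Rightarrow> bool" where
  "as_locally_sample_holder M Y k \<longleftrightarrow>
     (AE \<omega> in M. \<forall>s\<in>unit_sphere.
        \<exists>V C. openin (top_of_set unit_sphere) V \<and> s \<in> V \<and>
          (\<forall>u\<in>V. \<forall>v\<in>V. u \<noteq> v \<longrightarrow>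
             \<bar>(Y u \<omega> - Y v \<omega>) / geodesic_dist u v powr k\<bar> \<le> C))"

(*
  The finite-dimensional distributions of a field do not determine the regularity of its
  sample paths: adding the indicator of {u = U}, for an independent uniform random point U,
  to a field changes neither Gaussianity nor the covariance, but destroys continuity.
  Path regularity is therefore understood, as usual, either up to modification or for
  separable fields.
*)

definition modification_on ::
    "'t set \<Rightarrow> 'w measure \<Rightarrow> ('t \<Rightarrow> 'w \<Rightarrow> real) \<Rightarrow> ('t \<Rightarrow> 'w \<Rightarrow> real) \<Rightarrow> bool" where
  "modification_on T M Y Z \<longleftrightarrow>
     random_field_on T M Z \<and> (\<forall>u\<in>T. AE \<omega> in M. Z u \<omega> = Y u \<omega>)"

(*
  Separability in the sense of Doob: outside one null set, and for all relatively open G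
  and closed intervals I, having values in I on G is the same as having values in I on the
  part of G that lies in the countable set D. Density of D in T need not be demanded: if G
  is nonempty and misses D, the condition fails for disjoint intervals.
*)
definition separable_field_on ::
    "'t::topological_space set \<Rightarrow> 'w measure \<Rightarrow> ('t \<Rightarrow> 'w \<Rightarrow> real) \<Rightarrow> bool" where
  "separable_field_on T M Y \<longleftrightarrow>
     (\<exists>D\<subseteq>T. countable D \<and>
        (AE \<omega> in M. \<forall>G a b. openin (top_of_set T) G \<longrightarrow>
           ((\<forall>u\<in>G. Y u \<omega> \<in> {a..b}) \<longleftrightarrow> (\<forall>u\<in>G \<inter> D. Y u \<omega> \<in> {a..b}))))"

end

theory Submission
  imports Defs
begin

text \<open>The multiquadric covariance is a function of \<open>u \<bullet> v\<close>, the cosine of the geodesic distance,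
and it falls off at most linearly from its value at \<open>1\<close>. So the variance of an increment
\<open>Y u - Y v\<close> is at most \<open>L * (1 - u \<bullet> v)\<close>, that is, of order \<open>dist u v ^ 2\<close>. Increments of a
centred Gaussian field are centred normal variables, whose moment of order \<open>2 * p\<close> is a multiple
of the \<open>p\<close>-th power of the variance. Hence \<open>E (\<bar>Y u - Y v\<bar> ^ (2 * p)) \<le> C * dist u v ^ (2 * p)\<close>
for every \<open>p\<close>, with \<open>C\<close> depending on \<open>p\<close> (lemma \<open>multiquadric_field_moments\<close>).

Such moment bounds give regular paths by chaining, in the manner of Kolmogorov and Chentsov. Each
point \<open>u\<close> is approximated by points \<open>\<pi> n u\<close> at distance of order \<open>2 ^ -n\<close>, taken from a finite set
whose size grows like \<open>q ^ n\<close>. Because \<open>p\<close> may be taken as large as desired, a crude count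
suffices: with all \<open>q ^ (2 * n)\<close> pairs of net points allowed at level \<open>n\<close>, the expectation of the
sum over \<open>n\<close> and over all pairs at distance of order \<open>2 ^ -n\<close> of \<open>(\<bar>Y a - Y b\<bar> / \<rho> ^ n) ^ (2 * p)\<close>
is still finite for \<open>\<rho> = 2 powr - k\<close> with \<open>k < 1\<close>. The sum is therefore almost surely finite, and
as it dominates each of its terms, almost surely all increments over close pairs of level \<open>n\<close> are
at most \<open>A * \<rho> ^ n\<close> for one random constant \<open>A\<close> (lemma \<open>chain_increments_AE\<close>). On this event
\<open>Y (\<pi> n u)\<close> converges for all \<open>u\<close> at once, and the limit \<open>Z u\<close> is Hoelder continuous of order \<open>k\<close>:
two points at distance about \<open>2 ^ -n\<close> are compared through their approximations of level \<open>n\<close>. The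
field \<open>Z\<close> does not depend on \<open>k\<close>, and it is a modification of \<open>Y\<close>.

A separable field with a continuous modification \<open>Z\<close> almost surely agrees with \<open>Z\<close> on the
countable separating set, and separability spreads this agreement to all points; so the paths of a
separable \<open>Y\<close> are those of \<open>Z\<close>. The passage from the Euclidean distance to the geodesic one costs
nothing, since a chord is shorter than its arc.\<close>

section \<open>Moments of the increments\<close>

text \<open>Normality allows a point mass. With mean zero the variable is then almost surely \<open>0\<close>, which
satisfies the same moment formula as the nondegenerate case. The case \<open>k = 1\<close> also provides square
integrability.\<close>

lemma normally_distributed_even_moment:
  fixes X :: "'w \<Rightarrow> real"
  assumes "prob_space M" and nd: "normally_distributed M X" and mean: "integral\<^sup>L M X = 0"
  shows "has_bochner_integral M (\<lambda>\<omega>. X \<omega> ^ (2 * k))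
           (fact (2 * k) / (2 ^ k * fact k) * (\<integral>\<omega>. (X \<omega>)\<^sup>2 \<partial>M) ^ k)"
proof -
  interpret prob_space M by fact
  have X[measurable]: "X \<in> borel_measurable M"
    using nd by (simp add: normally_distributed_def)
  consider (point) m where "distr M borel X = return borel m"
    | (normal) m s where "s > 0" "distributed M lborel X (normal_density m s)"
    using nd by (auto simp: normally_distributed_def)
  then show ?thesis
  proof cases
    case point
    have "AE x in distr M borel X. x = m"
      unfolding point by (subst AE_return) auto
    then have Xm: "AE \<omega> in M. X \<omega> = m"
      by (subst (asm) AE_distr_iff) auto
    then have "integral\<^sup>L M X = (\<integral>\<omega>. m \<partial>M)"
      by (intro integral_cong_AE) auto
    with mean have "m = 0" by (simp add: prob_space)
    with Xm have X0: "AE \<omega> in M. X \<omega> = 0" by simp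
    then have sq0: "(\<integral>\<omega>. (X \<omega>)\<^sup>2 \<partial>M) = 0"
      by (intro integral_eq_zero_AE) auto
    have "has_bochner_integral M (\<lambda>\<omega>. 0 ^ (2 * k) :: real) (0 ^ (2 * k))"
      by (simp add: has_bochner_integral_iff prob_space)
    moreover have "AE \<omega> in M. 0 ^ (2 * k) = X \<omega> ^ (2 * k)"
      using X0 by auto
    ultimately have "has_bochner_integral M (\<lambda>\<omega>. X \<omega> ^ (2 * k)) (0 ^ (2 * k))"
      by (subst has_bochner_integral_cong_AE[symmetric]) auto
    then show ?thesis
      unfolding sq0 by (cases "k = 0") (auto simp: zero_power)
  next
    case normal
    have "m = integral\<^sup>L M X"
      using integral_normal_moment_nz_1[OF normal(1), of m]
        distributed_integral[OF normal(2), of "\<lambda>x. x"] normal(1) by simp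
    with mean have m: "m = 0" by simp
    have moments: "has_bochner_integral M (\<lambda>\<omega>. X \<omega> ^ (2 * j)) (fact (2 * j) / ((2 / s\<^sup>2) ^ j * fact j))" for j
      using normal_moment_even[OF normal(1), of m j]
        distributed_integral[OF normal(2), of "\<lambda>x. x ^ (2 * j)"]
        distributed_integrable[OF normal(2), of "\<lambda>x. x ^ (2 * j)"]
      by (simp add: has_bochner_integral_iff m)
    have "(\<integral>\<omega>. (X \<omega>)\<^sup>2 \<partial>M) = s\<^sup>2"
      using has_bochner_integral_integral_eq[OF moments[of 1]] normal(1) by (simp add: fact_numeral)
    then show ?thesis
      using moments[of k] by (simp add: power_divide)
  qed
qed

text \<open>With \<open>y\<close> the base of the power, \<open>y powr \<tau> \<ge> 1 + \<tau> * ln y\<close> and \<open>ln y \<ge> 1 - 1 / y\<close>. Passing to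
\<open>1 / y\<close> is what makes the bound linear, because \<open>1 / y\<close> is an affine function of \<open>t\<close>.\<close>

lemma multiquadric_increment:
  assumes "0 < \<delta>" "\<delta> < 1" "0 < \<tau>" "-1 \<le> t" "t \<le> 1"
  shows "\<sigma>\<^sup>2 - multiquadric \<sigma> \<delta> \<tau> (arccos t) \<le> \<sigma>\<^sup>2 * \<tau> * (2 * \<delta> / (1 - \<delta>)\<^sup>2) * (1 - t)"
proof -
  define y where "y = (1 - \<delta>)\<^sup>2 / (1 + \<delta>\<^sup>2 - 2 * \<delta> * t)"
  have "0 < (1 - \<delta>)\<^sup>2" using assms by simp
  also have "(1 - \<delta>)\<^sup>2 \<le> 1 + \<delta>\<^sup>2 - 2 * \<delta> * t"
    using mult_left_mono[OF assms(5), of \<delta>] assms(1) by (simp add: power2_eq_square algebra_simps)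
  finally have den: "0 < 1 + \<delta>\<^sup>2 - 2 * \<delta> * t" .
  have y: "0 < y" using assms den by (simp add: y_def)
  have "1 + \<delta>\<^sup>2 - 2 * \<delta> * t = (1 - \<delta>)\<^sup>2 + 2 * \<delta> * (1 - t)"
    by (simp add: power2_eq_square algebra_simps)
  then have inv: "1 / y - 1 = 2 * \<delta> / (1 - \<delta>)\<^sup>2 * (1 - t)"
    using assms by (simp add: y_def add_divide_distrib)
  have "ln (1 / y) \<le> 1 / y - 1"
    using y by (intro ln_le_minus_one) simp
  then have "\<tau> * (- ln y) \<le> \<tau> * (1 / y - 1)"
    using y assms by (intro mult_left_mono) (auto simp: ln_div)
  moreover have "1 + \<tau> * ln y \<le> y powr \<tau>"
    using exp_ge_add_one_self[of "\<tau> * ln y"] y by (simp add: powr_def)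
  ultimately have "1 - y powr \<tau> \<le> \<tau> * (1 / y - 1)" by simp
  then have "\<sigma>\<^sup>2 * (1 - y powr \<tau>) \<le> \<sigma>\<^sup>2 * (\<tau> * (1 / y - 1))"
    by (intro mult_left_mono) auto
  moreover have "multiquadric \<sigma> \<delta> \<tau> (arccos t) = \<sigma>\<^sup>2 * y powr \<tau>"
    using assms by (simp add: multiquadric_def y_def)
  ultimately show ?thesis
    unfolding inv by (simp add: algebra_simps)
qed

lemma norm_diff_sphere:
  fixes u v :: "'a :: real_inner"
  assumes "norm u = 1" "norm v = 1"
  shows "(norm (u - v))\<^sup>2 = 2 * (1 - u \<bullet> v)"
  using assms by (simp add: power2_norm_eq_inner inner_diff inner_commute norm_eq_1)

text \<open>A chord has length \<open>2 * sin (\<theta> / 2)\<close>, where \<open>\<theta>\<close> is the length of the arc.\<close>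

lemma norm_diff_le_geodesic_dist:
  fixes u v :: "real ^ 'n"
  assumes "norm u = 1" "norm v = 1"
  shows "norm (u - v) \<le> geodesic_dist u v"
proof -
  define \<theta> where "\<theta> = geodesic_dist u v"
  have uv: "\<bar>u \<bullet> v\<bar> \<le> 1"
    using Cauchy_Schwarz_ineq2[of u v] assms by simp
  then have \<theta>: "0 \<le> \<theta>" and c: "cos \<theta> = u \<bullet> v"
    by (auto simp: \<theta>_def geodesic_dist_def intro!: arccos_lbound)
  have "(norm (u - v))\<^sup>2 = (2 * sin (\<theta> / 2))\<^sup>2"
    using norm_diff_sphere[OF assms] cos_double_sin[of "\<theta> / 2"] c by (simp add: power_mult_distrib)
  also have "\<dots> = (2 * \<bar>sin (\<theta> / 2)\<bar>)\<^sup>2"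
    by (simp add: power_mult_distrib)
  also have "\<dots> \<le> \<theta>\<^sup>2"
    using abs_sin_x_le_abs_x[of "\<theta> / 2"] \<theta> by (intro power_mono) auto
  finally show ?thesis
    using \<theta> unfolding \<theta>_def by (rule power2_le_imp_le)
qed

lemma multiquadric_field_moments:
  fixes Y :: "real ^ 'n \<Rightarrow> 'w \<Rightarrow> real"
  assumes gauss: "gaussian_field_on unit_sphere M Y" and mean: "mean_zero_on unit_sphere M Y"
    and cov: "has_multiquadric_covariance M Y"
  shows "\<exists>C\<ge>0. \<forall>u\<in>unit_sphere. \<forall>v\<in>unit_sphere.
           (\<integral>\<^sup>+\<omega>. ennreal (\<bar>Y u \<omega> - Y v \<omega>\<bar> ^ (2 * p)) \<partial>M) \<le> ennreal (C * dist u v ^ (2 * p))"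
proof -
  interpret prob_space M using gauss by (simp add: gaussian_field_on_def random_field_on_def)
  obtain \<sigma> \<delta> \<tau> where par: "0 < \<sigma>" "0 < \<delta>" "\<delta> < 1" "0 < \<tau>"
    and cov: "\<And>u v. norm u = 1 \<Longrightarrow> norm v = 1 \<Longrightarrow>
      (\<integral>\<omega>. Y u \<omega> * Y v \<omega> \<partial>M) = multiquadric \<sigma> \<delta> \<tau> (geodesic_dist u v)"
    using cov by (auto simp: has_multiquadric_covariance_def)
  have nd: "normally_distributed M (\<lambda>\<omega>. \<Sum>i<n. a i * Y (u i) \<omega>)"
    if "n > 0" "\<And>i. i < n \<Longrightarrow> norm (u i) = 1" for n a and u :: "nat \<Rightarrow> real ^ 'n"
    using gauss that by (simp add: gaussian_field_on_def)
  have Ym: "norm u = 1 \<Longrightarrow> Y u \<in> borel_measurable M" for u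
    using gauss by (simp add: gaussian_field_on_def random_field_on_def)
  have mean: "norm u = 1 \<Longrightarrow> integral\<^sup>L M (Y u) = 0" for u
    using mean by (simp add: mean_zero_on_def)
  have sq: "integrable M (\<lambda>\<omega>. (Y u \<omega>)\<^sup>2)" if u: "norm u = 1" for u
  proof -
    have "normally_distributed M (Y u)"
      using nd[of 1 "\<lambda>_. u" "\<lambda>_. 1"] u by simp
    from normally_distributed_even_moment[OF prob_space_axioms this mean[OF u], of 1]
    show ?thesis by (simp add: has_bochner_integral_iff)
  qed
  have int: "integrable M (Y u)" if "norm u = 1" for u
    by (rule square_integrable_imp_integrable[OF Ym[OF that] sq[OF that]])
  have int2: "integrable M (\<lambda>\<omega>. Y u \<omega> * Y v \<omega>)" if "norm u = 1" "norm v = 1" for u v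
  proof (rule Bochner_Integration.integrable_bound)
    show "integrable M (\<lambda>\<omega>. (Y u \<omega>)\<^sup>2 + (Y v \<omega>)\<^sup>2)"
      by (intro Bochner_Integration.integrable_add sq that)
    have "\<bar>x * y\<bar> \<le> x\<^sup>2 + y\<^sup>2" for x y :: real
    proof -
      have "2 * (\<bar>x\<bar> * \<bar>y\<bar>) \<le> x\<^sup>2 + y\<^sup>2"
        using sum_squares_bound[of "\<bar>x\<bar>" "\<bar>y\<bar>"] by (simp add: mult.assoc)
      moreover have "0 \<le> \<bar>x\<bar> * \<bar>y\<bar>" by simp
      ultimately show ?thesis unfolding abs_mult by linarith
    qed
    then show "AE \<omega> in M. norm (Y u \<omega> * Y v \<omega>) \<le> norm ((Y u \<omega>)\<^sup>2 + (Y v \<omega>)\<^sup>2)"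
      by simp
  qed (intro borel_measurable_times Ym that)
  define L where "L = \<sigma>\<^sup>2 * \<tau> * (2 * \<delta> / (1 - \<delta>)\<^sup>2)"
  have L: "L \<ge> 0" using par by (simp add: L_def)
  define c :: real where "c = fact (2 * p) / (2 ^ p * fact p)"
  have c: "c \<ge> 0" by (simp add: c_def)
  have "(\<integral>\<^sup>+\<omega>. ennreal (\<bar>Y u \<omega> - Y v \<omega>\<bar> ^ (2 * p)) \<partial>M) \<le> ennreal (c * L ^ p * dist u v ^ (2 * p))"
    if u: "norm u = 1" and v: "norm v = 1" for u v
  proof -
    let ?X = "\<lambda>\<omega>. Y u \<omega> - Y v \<omega>"
    have X: "normally_distributed M ?X"
      using nd[of 2 "\<lambda>i. if i = 0 then u else v" "\<lambda>i. if i = 0 then 1 else -1"] u v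
      by (simp add: numeral_2_eq_2)
    have X0: "integral\<^sup>L M ?X = 0"
      using mean int u v by (subst Bochner_Integration.integral_diff) auto
    have diag: "(\<integral>\<omega>. (Y w \<omega>)\<^sup>2 \<partial>M) = \<sigma>\<^sup>2" if "norm w = 1" for w
    proof -
      have "w \<bullet> w = 1" using that by (simp add: norm_eq_1)
      moreover have "1 + \<delta>\<^sup>2 - 2 * \<delta> = (1 - \<delta>)\<^sup>2"
        by (simp add: power2_eq_square algebra_simps)
      then have "multiquadric \<sigma> \<delta> \<tau> (arccos 1) = \<sigma>\<^sup>2"
        using par by (simp add: multiquadric_def)
      ultimately show ?thesis
        using cov[OF that that] by (simp add: geodesic_dist_def power2_eq_square)
    qed
    have "(\<integral>\<omega>. (?X \<omega>)\<^sup>2 \<partial>M) = (\<integral>\<omega>. (Y u \<omega>)\<^sup>2 + (Y v \<omega>)\<^sup>2 - 2 * (Y u \<omega> * Y v \<omega>) \<partial>M)"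
      by (simp add: power2_diff mult.assoc)
    also have "\<dots> = \<sigma>\<^sup>2 + \<sigma>\<^sup>2 - 2 * multiquadric \<sigma> \<delta> \<tau> (arccos (u \<bullet> v))"
      using sq[OF u] sq[OF v] int2[OF u v] diag[OF u] diag[OF v] cov[OF u v]
      by (simp add: geodesic_dist_def)
    also have "\<dots> \<le> 2 * (L * (1 - u \<bullet> v))"
      using multiquadric_increment[of \<delta> \<tau> "u \<bullet> v" \<sigma>] par Cauchy_Schwarz_ineq2[of u v] u v
      by (simp add: L_def abs_le_iff)
    also have "\<dots> = L * (dist u v)\<^sup>2"
      using norm_diff_sphere[OF u v] by (simp add: dist_norm)
    finally have var: "(\<integral>\<omega>. (?X \<omega>)\<^sup>2 \<partial>M) \<le> L * (dist u v)\<^sup>2" .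
    note mom = normally_distributed_even_moment[OF prob_space_axioms X X0, of p, folded c_def]
    have "(\<integral>\<^sup>+\<omega>. ennreal (\<bar>?X \<omega>\<bar> ^ (2 * p)) \<partial>M) = (\<integral>\<^sup>+\<omega>. ennreal (?X \<omega> ^ (2 * p)) \<partial>M)"
      by (simp add: power_even_abs)
    also have "\<dots> = ennreal (c * (\<integral>\<omega>. (?X \<omega>)\<^sup>2 \<partial>M) ^ p)"
      using mom by (subst nn_integral_eq_integral) (auto simp: has_bochner_integral_iff)
    also have "\<dots> \<le> ennreal (c * (L * (dist u v)\<^sup>2) ^ p)"
      using var c by (intro ennreal_leI mult_left_mono power_mono) auto
    finally show ?thesis
      by (simp add: power_mult_distrib power_mult mult.assoc)
  qed
  then show ?thesis
    using c L by (intro exI[of _ "c * L ^ p"]) auto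
qed

section \<open>Chaining\<close>

text \<open>The union bound of the chaining argument, in integrated form. The sets \<open>B n\<close> have at most
\<open>(c * q ^ n)\<^sup>2\<close> pairs, and a pair at distance at most \<open>r / 2 ^ n\<close> contributes at most
\<open>C * (r / (2 * \<rho>) ^ n) ^ p\<close> to the expected sum of the \<open>(\<bar>Y a - Y b\<bar> / \<rho> ^ n) ^ p\<close>; the condition
\<open>q\<^sup>2 < (2 * \<rho>) ^ p\<close> says precisely that the total is a convergent geometric series. The same lemma
serves for the pairs that occur in the comparison of different points and, with \<open>q = 1\<close>, for the
pairs consisting of a fixed point and its approximations.\<close>

lemma chain_increments_AE:
  fixes Y :: "'a::metric_space \<Rightarrow> 'w \<Rightarrow> real" and B :: "nat \<Rightarrow> 'a set"
  assumes meas: "\<And>u. u \<in> T \<Longrightarrow> Y u \<in> borel_measurable M"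
    and mom: "\<And>u v. u \<in> T \<Longrightarrow> v \<in> T \<Longrightarrow>
      (\<integral>\<^sup>+\<omega>. ennreal (\<bar>Y u \<omega> - Y v \<omega>\<bar> ^ p) \<partial>M) \<le> ennreal (C * dist u v ^ p)"
    and C: "C \<ge> 0" and r: "r \<ge> 0"
    and BT: "\<And>n. B n \<subseteq> T" and fin: "\<And>n. finite (B n)"
    and card: "\<And>n. real (card (B n)) \<le> c * q ^ n"
    and \<rho>: "0 < \<rho>" and p: "p > 0" and ratio: "0 \<le> q" "q\<^sup>2 < (2 * \<rho>) ^ p"
  shows "AE \<omega> in M. \<exists>A\<ge>0. \<forall>n. \<forall>a\<in>B n. \<forall>b\<in>B n. dist a b \<le> r / 2 ^ n \<longrightarrow>
           \<bar>Y a \<omega> - Y b \<omega>\<bar> \<le> A * \<rho> ^ n"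
proof -
  define P where "P n = {x \<in> B n \<times> B n. dist (fst x) (snd x) \<le> r / 2 ^ n}" for n
  have PT: "fst x \<in> T" "snd x \<in> T" if "x \<in> P n" for x n
    using that BT[of n] by (auto simp: P_def)
  have finP: "finite (P n)" for n
    using fin by (simp add: P_def)
  have c0: "0 \<le> c * q ^ n" for n
    using order_trans[OF _ card[of n]] by simp
  have cardP: "real (card (P n)) \<le> (c * q ^ n)\<^sup>2" for n
  proof -
    have "card (P n) \<le> card (B n \<times> B n)"
      using fin by (intro card_mono) (auto simp: P_def)
    then have "real (card (P n)) \<le> (real (card (B n)))\<^sup>2"
      by (metis card_cartesian_product of_nat_le_iff of_nat_mult power2_eq_square)
    also have "\<dots> \<le> (c * q ^ n)\<^sup>2"
      using card by (intro power_mono) auto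
    finally show ?thesis .
  qed
  have [measurable]: "Y (fst x) \<in> borel_measurable M" "Y (snd x) \<in> borel_measurable M"
    if "x \<in> P n" for x n
    using PT[OF that] meas by auto
  define S where "S \<omega> = (\<Sum>n. \<Sum>x\<in>P n. ennreal (\<bar>Y (fst x) \<omega> - Y (snd x) \<omega>\<bar> ^ p / (\<rho> ^ n) ^ p))" for \<omega>
  have Sm: "S \<in> borel_measurable M"
    unfolding S_def by (intro borel_measurable_suminf_order borel_measurable_sum) measurable
  define K where "K = c\<^sup>2 * C * r ^ p"
  have K: "K \<ge> 0" using C r by (simp add: K_def)
  define z where "z = q\<^sup>2 / (2 * \<rho>) ^ p"
  have z: "0 \<le> z" "z < 1"
    using ratio \<rho> by (auto simp: z_def divide_less_eq)
  have level: "(\<integral>\<^sup>+\<omega>. (\<Sum>x\<in>P n. ennreal (\<bar>Y (fst x) \<omega> - Y (snd x) \<omega>\<bar> ^ p / (\<rho> ^ n) ^ p)) \<partial>M)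
      \<le> ennreal (K * z ^ n)" for n
  proof -
    have single: "(\<integral>\<^sup>+\<omega>. ennreal (\<bar>Y (fst x) \<omega> - Y (snd x) \<omega>\<bar> ^ p / (\<rho> ^ n) ^ p) \<partial>M)
        \<le> ennreal (C * (r / 2 ^ n) ^ p / (\<rho> ^ n) ^ p)" if x: "x \<in> P n" for x
    proof -
      note [measurable] = meas[OF PT(1)[OF x]] meas[OF PT(2)[OF x]]
      have "(\<integral>\<^sup>+\<omega>. ennreal (\<bar>Y (fst x) \<omega> - Y (snd x) \<omega>\<bar> ^ p / (\<rho> ^ n) ^ p) \<partial>M)
          = (\<integral>\<^sup>+\<omega>. ennreal (1 / (\<rho> ^ n) ^ p) * ennreal (\<bar>Y (fst x) \<omega> - Y (snd x) \<omega>\<bar> ^ p) \<partial>M)"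
        using \<rho> by (intro nn_integral_cong) (simp add: ennreal_mult[symmetric])
      also have "\<dots> = ennreal (1 / (\<rho> ^ n) ^ p) * (\<integral>\<^sup>+\<omega>. ennreal (\<bar>Y (fst x) \<omega> - Y (snd x) \<omega>\<bar> ^ p) \<partial>M)"
        by (rule nn_integral_cmult) measurable
      also have "\<dots> \<le> ennreal (1 / (\<rho> ^ n) ^ p) * ennreal (C * dist (fst x) (snd x) ^ p)"
        by (intro mult_left_mono mom PT[OF x]) simp
      also have "\<dots> \<le> ennreal (1 / (\<rho> ^ n) ^ p) * ennreal (C * (r / 2 ^ n) ^ p)"
        using x C by (intro mult_left_mono ennreal_leI power_mono) (auto simp: P_def)
      also have "\<dots> = ennreal (C * (r / 2 ^ n) ^ p / (\<rho> ^ n) ^ p)"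
        using \<rho> C r by (simp add: ennreal_mult[symmetric])
      finally show ?thesis .
    qed
    have "(\<integral>\<^sup>+\<omega>. (\<Sum>x\<in>P n. ennreal (\<bar>Y (fst x) \<omega> - Y (snd x) \<omega>\<bar> ^ p / (\<rho> ^ n) ^ p)) \<partial>M)
        = (\<Sum>x\<in>P n. \<integral>\<^sup>+\<omega>. ennreal (\<bar>Y (fst x) \<omega> - Y (snd x) \<omega>\<bar> ^ p / (\<rho> ^ n) ^ p) \<partial>M)"
      by (intro nn_integral_sum) measurable
    also have "\<dots> \<le> (\<Sum>x\<in>P n. ennreal (C * (r / 2 ^ n) ^ p / (\<rho> ^ n) ^ p))"
      by (intro sum_mono single)
    also have "\<dots> = ennreal (real (card (P n)) * (C * (r / 2 ^ n) ^ p / (\<rho> ^ n) ^ p))"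
      using C r \<rho> by (subst sum_ennreal) auto
    also have "\<dots> \<le> ennreal ((c * q ^ n)\<^sup>2 * (C * (r / 2 ^ n) ^ p / (\<rho> ^ n) ^ p))"
      using C r \<rho> by (intro ennreal_leI mult_right_mono cardP) auto
    also have "(c * q ^ n)\<^sup>2 * (C * (r / 2 ^ n) ^ p / (\<rho> ^ n) ^ p) = K * z ^ n"
      by (simp add: K_def z_def power_mult_distrib power_divide power_mult[symmetric] mult.commute)
    finally show ?thesis .
  qed
  have "(\<integral>\<^sup>+\<omega>. S \<omega> \<partial>M) = (\<Sum>n. \<integral>\<^sup>+\<omega>. (\<Sum>x\<in>P n. ennreal (\<bar>Y (fst x) \<omega> - Y (snd x) \<omega>\<bar> ^ p / (\<rho> ^ n) ^ p)) \<partial>M)"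
    unfolding S_def by (intro nn_integral_suminf borel_measurable_sum) measurable
  also have "\<dots> \<le> (\<Sum>n. ennreal (K * z ^ n))"
    by (intro suminf_le level) auto
  also have "\<dots> = ennreal (\<Sum>n. K * z ^ n)"
    using K z by (intro suminf_ennreal2 summable_mult summable_geometric) auto
  finally have "(\<integral>\<^sup>+\<omega>. S \<omega> \<partial>M) \<noteq> \<infinity>"
    by (auto simp: top_unique)
  then have "AE \<omega> in M. S \<omega> \<noteq> \<infinity>"
    using Sm by (intro nn_integral_PInf_AE) auto
  then show ?thesis
  proof eventually_elim
    case (elim \<omega>)
    \<comment> \<open>The maximum with \<open>1\<close> gives \<open>A \<le> A ^ p\<close>, which avoids taking a \<open>p\<close>-th root of the sum.\<close>
    define A where "A = max 1 (enn2real (S \<omega>))"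
    have "\<bar>Y a \<omega> - Y b \<omega>\<bar> \<le> A * \<rho> ^ n"
      if ab: "a \<in> B n" "b \<in> B n" "dist a b \<le> r / 2 ^ n" for n a b
    proof -
      let ?y = "\<bar>Y a \<omega> - Y b \<omega>\<bar> / \<rho> ^ n"
      have "(a, b) \<in> P n" using ab by (simp add: P_def)
      then have "ennreal (?y ^ p) \<le> (\<Sum>x\<in>P n. ennreal (\<bar>Y (fst x) \<omega> - Y (snd x) \<omega>\<bar> ^ p / (\<rho> ^ n) ^ p))"
        using finP member_le_sum[of "(a, b)" "P n" "\<lambda>x. ennreal (\<bar>Y (fst x) \<omega> - Y (snd x) \<omega>\<bar> ^ p / (\<rho> ^ n) ^ p)"]
        by (simp add: power_divide)
      also have "\<dots> \<le> S \<omega>"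
        using sum_le_suminf[of "\<lambda>n. \<Sum>x\<in>P n. ennreal (\<bar>Y (fst x) \<omega> - Y (snd x) \<omega>\<bar> ^ p / (\<rho> ^ n) ^ p)" "{n}"]
        unfolding S_def by simp
      also have "\<dots> = ennreal (enn2real (S \<omega>))"
        using elim by (simp add: less_top)
      finally have "?y ^ p \<le> enn2real (S \<omega>)"
        by (simp add: ennreal_le_iff)
      also have "\<dots> \<le> A" by (simp add: A_def)
      also have "A \<le> A ^ p"
        using p by (intro self_le_power) (auto simp: A_def)
      finally have "?y \<le> A"
        by (rule power_le_imp_le_base[of _ "p - 1", unfolded Suc_diff_1[OF p]]) (simp add: A_def)
      then show ?thesis
        using \<rho> by (simp add: divide_le_eq)
    qed
    then show ?case
      by (intro exI[of _ A]) (auto simp: A_def)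
  qed
qed

lemma geometric_increments_limit:
  fixes x :: "nat \<Rightarrow> real"
  assumes \<rho>: "0 < \<rho>" "\<rho> < 1" and step: "\<And>n. \<bar>x (Suc n) - x n\<bar> \<le> A * \<rho> ^ n"
  shows "x \<longlonglongrightarrow> lim x" and "\<bar>lim x - x n\<bar> \<le> A / (1 - \<rho>) * \<rho> ^ n"
proof -
  have "0 \<le> A" using order_trans[OF abs_ge_zero step[of 0]] by simp
  have tail: "\<bar>x (n + j) - x n\<bar> \<le> A / (1 - \<rho>) * \<rho> ^ n * (1 - \<rho> ^ j)" for n j
  proof (induction j)
    case (Suc j)
    have "A / (1 - \<rho>) * \<rho> ^ n * (1 - \<rho> ^ j) + A * \<rho> ^ (n + j) = A / (1 - \<rho>) * \<rho> ^ n * (1 - \<rho> ^ Suc j)"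
      using \<rho> by (simp add: divide_simps power_add) (simp add: algebra_simps)
    then show ?case
      using Suc step[of "n + j"] by simp
  qed simp
  have bound: "\<bar>x m - x n\<bar> \<le> A / (1 - \<rho>) * \<rho> ^ n" if "n \<le> m" for m n
  proof -
    have "A / (1 - \<rho>) * \<rho> ^ n * (1 - \<rho> ^ (m - n)) \<le> A / (1 - \<rho>) * \<rho> ^ n * 1"
      using \<rho> \<open>0 \<le> A\<close> by (intro mult_left_mono) auto
    then show ?thesis using tail[of n "m - n"] that by simp
  qed
  have "summable (\<lambda>n. x (Suc n) - x n)"
    using \<rho> by (intro summable_comparison_test'[OF summable_mult[OF summable_geometric], of \<rho> _ _ A])
      (auto intro: step)
  then have "convergent x"
    by (simp add: summable_iff_convergent sum_lessThan_telescope convergent_diff_const_right_iff)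
  then show lim: "x \<longlonglongrightarrow> lim x" by (simp add: convergent_LIMSEQ_iff)
  have "(\<lambda>m. \<bar>x m - x n\<bar>) \<longlonglongrightarrow> \<bar>lim x - x n\<bar>"
    by (intro tendsto_intros lim)
  then show "\<bar>lim x - x n\<bar> \<le> A / (1 - \<rho>) * \<rho> ^ n"
    by (rule LIMSEQ_le_const2) (use bound in auto)
qed

text \<open>The deterministic half of the chaining argument, for a single path \<open>f\<close>. The bound
\<open>(2 * m + R) / 2 ^ n\<close> covers both kinds of pairs that are compared: consecutive approximations
\<open>\<pi> n u\<close> and \<open>\<pi> (Suc n) u\<close>, and the approximations \<open>\<pi> n u\<close> and \<open>\<pi> n v\<close> of points at distance at
most \<open>R / 2 ^ n\<close>. As \<open>R\<close> bounds the diameter of \<open>T\<close>, every pair of distinct points has a level \<open>n\<close>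
with \<open>R / 2 ^ Suc n < dist u v \<le> R / 2 ^ n\<close>, and \<open>(2 powr - k) ^ n\<close> is then of the order
\<open>dist u v powr k\<close>.\<close>

lemma chain_limit_holder:
  fixes f :: "'a::metric_space \<Rightarrow> real" and \<pi> :: "nat \<Rightarrow> 'a \<Rightarrow> 'a"
  assumes k: "0 < k" and A: "A \<ge> 0" and R: "R > 0"
    and near: "\<And>n u. u \<in> T \<Longrightarrow> dist (\<pi> n u) u \<le> m / 2 ^ n"
    and diam: "\<And>u v. u \<in> T \<Longrightarrow> v \<in> T \<Longrightarrow> dist u v \<le> R"
    and incr: "\<And>n a b. a \<in> \<pi> n ` T \<union> \<pi> (Suc n) ` T \<Longrightarrow> b \<in> \<pi> n ` T \<union> \<pi> (Suc n) ` T \<Longrightarrow>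
      dist a b \<le> (2 * m + R) / 2 ^ n \<Longrightarrow> \<bar>f a - f b\<bar> \<le> A * (2 powr - k) ^ n"
  shows "\<exists>C. \<forall>u\<in>T. \<forall>v\<in>T. \<bar>lim (\<lambda>n. f (\<pi> n u)) - lim (\<lambda>n. f (\<pi> n v))\<bar> \<le> C * dist u v powr k"
proof (intro exI ballI)
  define \<rho> :: real where "\<rho> = 2 powr - k"
  have \<rho>: "0 < \<rho>" "\<rho> < 1" using k by (auto simp: \<rho>_def powr_less_one)
  define D where "D = A / (1 - \<rho>) + A / (1 - \<rho>) + A"
  have D: "D \<ge> 0" using A \<rho> by (simp add: D_def)
  fix u v assume u: "u \<in> T" and v: "v \<in> T"
  have m: "m \<ge> 0" using order_trans[OF zero_le_dist near[OF u, of 0]] by simp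
  have lims: "\<bar>lim (\<lambda>n. f (\<pi> n w)) - f (\<pi> n w)\<bar> \<le> A / (1 - \<rho>) * \<rho> ^ n" if w: "w \<in> T" for w n
  proof (rule geometric_increments_limit(2)[OF \<rho>])
    fix n
    have "dist (\<pi> (Suc n) w) (\<pi> n w) \<le> m / 2 ^ Suc n + m / 2 ^ n"
      using near[OF w, of n] near[OF w, of "Suc n"] dist_triangle2[of "\<pi> (Suc n) w" "\<pi> n w" w] by simp
    also have "\<dots> \<le> (2 * m + R) / 2 ^ n"
      using m R by (simp add: field_simps)
    finally show "\<bar>f (\<pi> (Suc n) w) - f (\<pi> n w)\<bar> \<le> A * \<rho> ^ n"
      unfolding \<rho>_def using w by (intro incr) auto
  qed
  have scale: "\<bar>lim (\<lambda>n. f (\<pi> n u)) - lim (\<lambda>n. f (\<pi> n v))\<bar> \<le> D * \<rho> ^ n" if n: "dist u v \<le> R / 2 ^ n" for n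
  proof -
    have "dist (\<pi> n u) (\<pi> n v) \<le> dist (\<pi> n u) u + dist u v + dist (\<pi> n v) v"
      using dist_triangle[of "\<pi> n u" "\<pi> n v" u] dist_triangle[of u "\<pi> n v" v]
      by (simp add: dist_commute)
    also have "\<dots> \<le> m / 2 ^ n + R / 2 ^ n + m / 2 ^ n"
      using near[OF u] near[OF v] n by (intro add_mono) auto
    finally have "dist (\<pi> n u) (\<pi> n v) \<le> (2 * m + R) / 2 ^ n"
      by (simp add: field_simps)
    then have "\<bar>f (\<pi> n u) - f (\<pi> n v)\<bar> \<le> A * \<rho> ^ n"
      unfolding \<rho>_def using u v by (intro incr) auto
    then show ?thesis
      using lims[OF u, of n] lims[OF v, of n] unfolding D_def distrib_right by linarith
  qed
  show "\<bar>lim (\<lambda>n. f (\<pi> n u)) - lim (\<lambda>n. f (\<pi> n v))\<bar> \<le> D * (2 / R) powr k * dist u v powr k"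
  proof (cases "u = v")
    case False
    define n where "n = (LEAST n. R / 2 ^ Suc n < dist u v)"
    have "(\<lambda>n. R / 2 * (1 / 2) ^ n) \<longlonglongrightarrow> R / 2 * 0"
      by (intro tendsto_intros LIMSEQ_power_zero) auto
    then have "eventually (\<lambda>n. R / 2 * (1 / 2) ^ n < dist u v) sequentially"
      using False by (intro order_tendstoD(2)[of _ "R / 2 * 0"]) auto
    then have "\<exists>n. R / 2 ^ Suc n < dist u v"
      by (auto simp: eventually_sequentially power_divide)
    then have lower: "R / 2 ^ Suc n < dist u v"
      unfolding n_def by (rule LeastI_ex)
    have upper: "dist u v \<le> R / 2 ^ n"
    proof (cases n)
      case (Suc j)
      then have "\<not> R / 2 ^ Suc j < dist u v"
        using not_less_Least[of j "\<lambda>n. R / 2 ^ Suc n < dist u v"] by (simp add: n_def)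
      then show ?thesis using Suc by simp
    qed (use diam u v in simp)
    have "1 / 2 ^ n \<le> 2 / R * dist u v"
      using lower R by (simp add: field_simps)
    then have "(1 / 2 ^ n) powr k \<le> (2 / R * dist u v) powr k"
      using k by (intro powr_mono2) auto
    also have "(1 / 2 ^ n) powr k = \<rho> ^ n"
    proof -
      have "1 / 2 ^ n = (2::real) powr (- real n)"
        by (simp add: powr_minus powr_realpow divide_inverse)
      then show ?thesis
        by (simp add: \<rho>_def powr_powr powr_power mult.commute)
    qed
    also have "(2 / R * dist u v) powr k = (2 / R) powr k * dist u v powr k"
      by (rule powr_mult)
    finally have "D * \<rho> ^ n \<le> D * ((2 / R) powr k * dist u v powr k)"
      using D by (rule mult_left_mono)
    then show ?thesis
      using scale[OF upper] by (simp add: mult.assoc)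
  qed simp
qed

section \<open>Grid approximations\<close>

text \<open>The code of \<open>u\<close> names the half-open cube of side \<open>2 ^ -n\<close> that contains \<open>u\<close>. Restricting the
coordinate function to \<open>Basis\<close> makes the codes of a bounded set elements of a finite product of
integer intervals.\<close>

definition grid_code :: "nat \<Rightarrow> 'a::euclidean_space \<Rightarrow> 'a \<Rightarrow> int" where
  "grid_code n u = (\<lambda>b\<in>Basis. \<lfloor>2 ^ n * (u \<bullet> b)\<rfloor>)"

text \<open>The representative is chosen inside \<open>T\<close>, and not at the centre of the cube, because it has
to be an index at which a field on \<open>T\<close> is known.\<close>

definition grid_rep :: "'a::euclidean_space set \<Rightarrow> nat \<Rightarrow> 'a \<Rightarrow> 'a" where
  "grid_rep T n u = (SOME v. v \<in> T \<and> grid_code n v = grid_code n u)"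

lemma grid_rep:
  assumes "u \<in> T"
  shows grid_rep_in: "grid_rep T n u \<in> T"
    and grid_code_rep: "grid_code n (grid_rep T n u) = grid_code n u"
  using someI[of "\<lambda>v. v \<in> T \<and> grid_code n v = grid_code n u" u] assms
  by (auto simp: grid_rep_def)

lemma dist_grid_rep_le:
  fixes u :: "'a::euclidean_space"
  assumes "u \<in> T"
  shows "dist (grid_rep T n u) u \<le> real DIM('a) / 2 ^ n"
proof -
  let ?v = "grid_rep T n u"
  have "\<bar>(?v - u) \<bullet> b\<bar> \<le> 1 / 2 ^ n" if b: "b \<in> Basis" for b
  proof -
    have "\<lfloor>2 ^ n * (?v \<bullet> b)\<rfloor> = \<lfloor>2 ^ n * (u \<bullet> b)\<rfloor>"
      using fun_cong[OF grid_code_rep[OF assms, of n], of b] b by (simp add: grid_code_def)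
    then have "\<bar>2 ^ n * (?v \<bullet> b) - 2 ^ n * (u \<bullet> b)\<bar> \<le> 1"
      by linarith
    then have "2 ^ n * \<bar>(?v - u) \<bullet> b\<bar> \<le> 1"
      by (simp add: inner_diff_left right_diff_distrib[symmetric] abs_mult)
    then show ?thesis by (simp add: field_simps)
  qed
  then have "(\<Sum>b\<in>Basis. \<bar>(?v - u) \<bullet> b\<bar>) \<le> (\<Sum>b\<in>(Basis::'a set). 1 / 2 ^ n)"
    by (rule sum_mono)
  then show ?thesis
    using norm_le_l1[of "?v - u"] by (simp add: dist_norm)
qed

text \<open>A representative depends on its point only through the code, so there are at most as many
representatives as there are cubes that meet a large box.\<close>

lemma card_grid_reps:
  fixes T :: "'a::euclidean_space set"
  assumes "bounded T"
  shows "finite (grid_rep T n ` T)"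
    and "\<exists>c. \<forall>n. real (card (grid_rep T n ` T)) \<le> c * (2 ^ DIM('a)) ^ n"
proof -
  obtain r where r: "\<And>u. u \<in> T \<Longrightarrow> norm u \<le> r"
    using assms by (auto simp: bounded_iff)
  obtain K :: nat where K: "r \<le> real K" using real_arch_simple by blast
  define W where "W n = (\<Pi>\<^sub>E b\<in>(Basis :: 'a set). {- int (K * 2 ^ n)..int (K * 2 ^ n)})" for n
  have code: "grid_code n u \<in> W n" if u: "u \<in> T" for u n
  proof -
    have "\<lfloor>2 ^ n * (u \<bullet> b)\<rfloor> \<in> {- int (K * 2 ^ n)..int (K * 2 ^ n)}" if b: "b \<in> Basis" for b
    proof -
      have "\<bar>u \<bullet> b\<bar> \<le> real K"
        using Basis_le_norm[OF b, of u] r[OF u] K by linarith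
      then have "\<bar>2 ^ n * (u \<bullet> b)\<bar> \<le> 2 ^ n * real K"
        by (simp add: abs_mult)
      then have "- real_of_int (int (K * 2 ^ n)) \<le> 2 ^ n * (u \<bullet> b)" "2 ^ n * (u \<bullet> b) \<le> real_of_int (int (K * 2 ^ n))"
        by (simp_all add: abs_le_iff mult.commute)
      then show ?thesis
        unfolding atLeastAtMost_iff by (metis floor_mono floor_of_int le_floor_iff of_int_minus)
    qed
    then show ?thesis
      unfolding W_def grid_code_def by (intro restrict_PiE_iff[THEN iffD2]) auto
  qed
  have finW: "finite (W n)" for n
    unfolding W_def by (intro finite_PiE) auto
  define h where "h n = (\<lambda>w. SOME v. v \<in> T \<and> grid_code n v = w)" for n
  have img: "grid_rep T n ` T \<subseteq> h n ` W n" for n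
    using code by (auto simp: grid_rep_def h_def)
  show "finite (grid_rep T n ` T)"
    using finite_subset[OF img] finW by blast
  have cardW: "card (W n) = (2 * (K * 2 ^ n) + 1) ^ DIM('a)" for n
  proof -
    have "card {- int (K * 2 ^ n)..int (K * 2 ^ n)} = 2 * (K * 2 ^ n) + 1"
      by (simp add: nat_add_distrib nat_mult_distrib nat_power_eq)
    then show ?thesis unfolding W_def by (subst card_PiE) auto
  qed
  have "real (card (grid_rep T n ` T)) \<le> real (2 * K + 1) ^ DIM('a) * (2 ^ DIM('a)) ^ n" for n
  proof -
    have "card (grid_rep T n ` T) \<le> card (W n)"
      using card_mono[OF finite_imageI[OF finW] img] card_image_le[OF finW] order_trans by blast
    also have "\<dots> \<le> ((2 * K + 1) * 2 ^ n) ^ DIM('a)"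
      unfolding cardW by (intro power_mono) (auto simp: algebra_simps)
    also have "\<dots> = (2 * K + 1) ^ DIM('a) * (2 ^ DIM('a)) ^ n"
      unfolding power_mult_distrib power_mult[symmetric] by (simp only: mult.commute)
    finally have "real (card (grid_rep T n ` T)) \<le> real ((2 * K + 1) ^ DIM('a) * (2 ^ DIM('a)) ^ n)"
      by (simp only: of_nat_le_iff)
    then show ?thesis by simp
  qed
  then show "\<exists>c. \<forall>n. real (card (grid_rep T n ` T)) \<le> c * (2 ^ DIM('a)) ^ n" by blast
qed

section \<open>A continuous modification\<close>

text \<open>A version of the Kolmogorov--Chentsov theorem for fields whose increments have moments of
all orders, with the moment of order \<open>2 * p\<close> scaling like \<open>dist u v ^ (2 * p)\<close>. A single
modification has the stated regularity for every \<open>k\<close>, since it is the limit of \<open>Y\<close> along the grid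
representatives; only the exponent \<open>p\<close> and the exceptional null set depend on \<open>k\<close>.\<close>

theorem kolmogorov_chentsov_all_moments:
  fixes T :: "'a::euclidean_space set"
  assumes field: "random_field_on T M Y" and bdd: "bounded T"
    and mom: "\<And>p. \<exists>C\<ge>0. \<forall>u\<in>T. \<forall>v\<in>T.
      (\<integral>\<^sup>+\<omega>. ennreal (\<bar>Y u \<omega> - Y v \<omega>\<bar> ^ (2 * p)) \<partial>M) \<le> ennreal (C * dist u v ^ (2 * p))"
  shows "\<exists>Z. modification_on T M Y Z \<and>
    (\<forall>k\<in>{0<..<1}. AE \<omega> in M. \<exists>C. \<forall>u\<in>T. \<forall>v\<in>T. \<bar>Z u \<omega> - Z v \<omega>\<bar> \<le> C * dist u v powr k)"
proof -
  define \<pi> where "\<pi> = grid_rep T"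
  define m where "m = real DIM('a)"
  define Z where "Z u \<omega> = lim (\<lambda>n. Y (\<pi> n u) \<omega>)" for u \<omega>
  have prob: "prob_space M" and Ym: "\<And>u. u \<in> T \<Longrightarrow> Y u \<in> borel_measurable M"
    using field by (auto simp: random_field_on_def)
  have \<pi>T: "u \<in> T \<Longrightarrow> \<pi> n u \<in> T" for n u by (simp add: \<pi>_def grid_rep_in)
  have near: "u \<in> T \<Longrightarrow> dist (\<pi> n u) u \<le> m / 2 ^ n" for n u
    by (simp add: \<pi>_def m_def dist_grid_rep_le)
  have fin: "finite (\<pi> n ` T)" for n
    by (simp add: \<pi>_def card_grid_reps bdd)
  define q :: real where "q = 2 ^ DIM('a)"
  have q: "q \<ge> 1" by (simp add: q_def)
  obtain c where card: "\<And>n. real (card (\<pi> n ` T)) \<le> c * q ^ n"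
    using card_grid_reps(2)[OF bdd] by (auto simp: \<pi>_def q_def)
  obtain R where R: "R > 0" and diam: "\<And>u v. u \<in> T \<Longrightarrow> v \<in> T \<Longrightarrow> dist u v \<le> R"
  proof
    show "diameter T + 1 > 0" using diameter_ge_0[OF bdd] by simp
    show "dist u v \<le> diameter T + 1" if "u \<in> T" "v \<in> T" for u v
      using diameter_bounded_bound[OF bdd that] by simp
  qed
  \<comment> \<open>As \<open>2 * 2 powr - k > 1\<close> for \<open>k < 1\<close>, a high moment beats any exponential growth of the nets.\<close>
  have ratio: "\<exists>p>0. Q\<^sup>2 < (2 * 2 powr - k) ^ (2 * p)" if k: "k < 1" for k Q :: real
  proof -
    have "1 < 2 powr (1 - k)" using k by (simp add: gr_one_powr)
    also have "2 powr (1 - k) = 2 * 2 powr - k" by (simp add: powr_diff powr_minus divide_inverse)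
    finally have "1 < (2 * 2 powr - k :: real)" .
    then obtain p where p: "\<bar>Q\<bar> < (2 * 2 powr - k) ^ p"
      using real_arch_pow by blast
    also have "\<dots> \<le> (2 * 2 powr - k) ^ Suc p"
      using \<open>1 < 2 * 2 powr - k\<close> by (intro power_increasing) auto
    finally have "\<bar>Q\<bar>\<^sup>2 < ((2 * 2 powr - k) ^ Suc p)\<^sup>2"
      by (intro power_strict_mono) auto
    then have "Q\<^sup>2 < (2 * 2 powr - k) ^ (2 * Suc p)"
      by (simp only: power2_abs power_even_eq)
    then show ?thesis by blast
  qed
  have mod: "AE \<omega> in M. Z u \<omega> = Y u \<omega>" if u: "u \<in> T" for u
  proof -
    \<comment> \<open>The exponent \<open>1/2\<close> is arbitrary: any rate of decay gives convergence to \<open>Y u\<close>.\<close>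
    obtain p where p: "p > 0" "(1::real)\<^sup>2 < (2 * 2 powr - (1/2)) ^ (2 * p)"
      using ratio[of "1/2" 1] by auto
    obtain C where C: "C \<ge> 0" "\<And>u v. u \<in> T \<Longrightarrow> v \<in> T \<Longrightarrow>
        (\<integral>\<^sup>+\<omega>. ennreal (\<bar>Y u \<omega> - Y v \<omega>\<bar> ^ (2 * p)) \<partial>M) \<le> ennreal (C * dist u v ^ (2 * p))"
      using mom[of p] by blast
    have incr: "AE \<omega> in M. \<exists>A\<ge>0. \<forall>n. \<forall>a\<in>{u, \<pi> n u}. \<forall>b\<in>{u, \<pi> n u}. dist a b \<le> m / 2 ^ n \<longrightarrow>
        \<bar>Y a \<omega> - Y b \<omega>\<bar> \<le> A * (2 powr - (1/2)) ^ n"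
    proof (rule chain_increments_AE[where q = 1 and c = 2, OF Ym C(2) C(1)])
      show "(1::real)\<^sup>2 < (2 * 2 powr - (1/2)) ^ (2 * p)" by (fact p(2))
      show "real (card {u, \<pi> n u}) \<le> 2 * 1 ^ n" for n
        by (simp add: card_insert_if)
    qed (use u \<pi>T p(1) in \<open>auto simp: m_def\<close>)
    have "(2::real) powr - (1/2) < 2 powr 0"
      by (intro powr_less_mono) auto
    then have null: "(\<lambda>n. A * (2 powr - (1/2)) ^ n) \<longlonglongrightarrow> 0" for A :: real
      by (intro tendsto_mult_right_zero LIMSEQ_realpow_zero) simp_all
    from incr show ?thesis
    proof eventually_elim
      case (elim \<omega>)
      then obtain A where A: "\<And>n. \<bar>Y (\<pi> n u) \<omega> - Y u \<omega>\<bar> \<le> A * (2 powr - (1/2)) ^ n"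
        using near[OF u] by blast
      have "(\<lambda>n. Y (\<pi> n u) \<omega> - Y u \<omega>) \<longlonglongrightarrow> 0"
        by (rule Lim_null_comparison[OF _ null[of A]]) (use A in simp)
      then have "(\<lambda>n. Y (\<pi> n u) \<omega>) \<longlonglongrightarrow> Y u \<omega>"
        by (simp add: LIM_zero_iff)
      then show ?case unfolding Z_def by (rule limI)
    qed
  qed
  have holder: "AE \<omega> in M. \<exists>C. \<forall>u\<in>T. \<forall>v\<in>T. \<bar>Z u \<omega> - Z v \<omega>\<bar> \<le> C * dist u v powr k"
    if k: "0 < k" "k < 1" for k
  proof -
    \<comment> \<open>Two consecutive nets are joined, so that the steps from \<open>\<pi> n u\<close> to \<open>\<pi> (Suc n) u\<close> are included.\<close>
    define B where "B n = \<pi> n ` T \<union> \<pi> (Suc n) ` T" for n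
    obtain p where p: "p > 0" "q\<^sup>2 < (2 * 2 powr - k) ^ (2 * p)"
      using ratio[OF k(2)] by blast
    obtain C where C: "C \<ge> 0" "\<And>u v. u \<in> T \<Longrightarrow> v \<in> T \<Longrightarrow>
        (\<integral>\<^sup>+\<omega>. ennreal (\<bar>Y u \<omega> - Y v \<omega>\<bar> ^ (2 * p)) \<partial>M) \<le> ennreal (C * dist u v ^ (2 * p))"
      using mom[of p] by blast
    have cardB: "real (card (B n)) \<le> (c + c * q) * q ^ n" for n
    proof -
      have "real (card (B n)) \<le> real (card (\<pi> n ` T)) + real (card (\<pi> (Suc n) ` T))"
        unfolding B_def using card_Un_le[of "\<pi> n ` T" "\<pi> (Suc n) ` T"] by linarith
      also have "\<dots> \<le> c * q ^ n + c * q ^ Suc n"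
        by (intro add_mono card)
      finally show ?thesis by (simp add: algebra_simps)
    qed
    have "AE \<omega> in M. \<exists>A\<ge>0. \<forall>n. \<forall>a\<in>B n. \<forall>b\<in>B n. dist a b \<le> (2 * m + R) / 2 ^ n \<longrightarrow>
        \<bar>Y a \<omega> - Y b \<omega>\<bar> \<le> A * (2 powr - k) ^ n"
    proof (rule chain_increments_AE[where q = q, OF Ym C(2) C(1) _ _ _ cardB])
      show "q\<^sup>2 < (2 * 2 powr - k) ^ (2 * p)" by (fact p(2))
    qed (use \<pi>T p(1) q R fin in \<open>auto simp: m_def B_def\<close>)
    then show ?thesis
    proof eventually_elim
      case (elim \<omega>)
      then obtain A where "A \<ge> 0" and A: "\<And>n a b. a \<in> B n \<Longrightarrow> b \<in> B n \<Longrightarrow> dist a b \<le> (2 * m + R) / 2 ^ n \<Longrightarrow>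
        \<bar>Y a \<omega> - Y b \<omega>\<bar> \<le> A * (2 powr - k) ^ n" by blast
      then show ?case
        unfolding Z_def
        by (intro chain_limit_holder[where f = "\<lambda>u. Y u \<omega>" and \<pi> = \<pi> and m = m and R = R and A = A])
          (use k R near diam in \<open>auto simp: B_def\<close>)
    qed
  qed
  have "Z u \<in> borel_measurable M" if "u \<in> T" for u
    unfolding Z_def using Ym \<pi>T[OF that] by (intro borel_measurable_lim_metric) auto
  with mod holder prob show ?thesis
    by (intro exI[of _ Z]) (auto simp: modification_on_def random_field_on_def)
qed

section \<open>Separable fields\<close>

text \<open>For a point \<open>u\<close> and \<open>e > 0\<close>, let \<open>G\<close> be the relatively open set on which \<open>Z\<close> is within \<open>e\<close>
of \<open>Z u\<close>. On the separating points of \<open>G\<close> the field \<open>Y\<close> equals \<open>Z\<close>, so it takes values in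
\<open>{Z u - e..Z u + e}\<close> there; separability extends this to all of \<open>G\<close>, and in particular to \<open>u\<close>.\<close>

lemma separable_eq_continuous_modification:
  fixes T :: "'t::topological_space set"
  assumes sep: "separable_field_on T M Y" and mod: "modification_on T M Y Z"
    and cont: "AE \<omega> in M. continuous_on T (\<lambda>u. Z u \<omega>)"
  shows "AE \<omega> in M. \<forall>u\<in>T. Y u \<omega> = Z u \<omega>"
proof -
  obtain D where D: "D \<subseteq> T" "countable D"
    and sepD: "AE \<omega> in M. \<forall>G a b. openin (top_of_set T) G \<longrightarrow>
           ((\<forall>u\<in>G. Y u \<omega> \<in> {a..b}) \<longleftrightarrow> (\<forall>u\<in>G \<inter> D. Y u \<omega> \<in> {a..b}))"
    using sep by (auto simp: separable_field_on_def)
  have "AE \<omega> in M. \<forall>u\<in>D. Z u \<omega> = Y u \<omega>"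
    using mod D by (auto simp: modification_on_def AE_ball_countable)
  with sepD cont show ?thesis
  proof eventually_elim
    case (elim \<omega>)
    show ?case
    proof (intro ballI)
      fix u assume u: "u \<in> T"
      have "\<bar>Y u \<omega> - Z u \<omega>\<bar> \<le> 0 + e" if e: "e > 0" for e
      proof -
        define G where "G = T \<inter> (\<lambda>v. Z v \<omega>) -` {Z u \<omega> - e<..<Z u \<omega> + e}"
        have "openin (top_of_set T) G"
          unfolding G_def by (intro continuous_openin_preimage_gen elim(2)) auto
        moreover have "\<forall>v\<in>G \<inter> D. Y v \<omega> \<in> {Z u \<omega> - e..Z u \<omega> + e}"
          using elim(3) by (force simp: G_def)
        ultimately have "\<forall>v\<in>G. Y v \<omega> \<in> {Z u \<omega> - e..Z u \<omega> + e}"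
          using elim(1) by blast
        moreover have "u \<in> G" using u e by (simp add: G_def)
        ultimately show ?thesis by (auto simp: abs_le_iff)
      qed
      then have "\<bar>Y u \<omega> - Z u \<omega>\<bar> \<le> 0" by (rule field_le_epsilon)
      then show "Y u \<omega> = Z u \<omega>" by simp
    qed
  qed
qed

lemma holder_imp_continuous_on:
  fixes f :: "'a::metric_space \<Rightarrow> real"
  assumes k: "k > 0" and f: "\<And>u v. u \<in> T \<Longrightarrow> v \<in> T \<Longrightarrow> \<bar>f u - f v\<bar> \<le> C * dist u v powr k"
  shows "continuous_on T f"
  unfolding continuous_on_def
proof
  fix u assume u: "u \<in> T"
  have "((\<lambda>v. dist v u) \<longlongrightarrow> dist u u) (at u within T)"
    by (intro tendsto_intros)
  then have "((\<lambda>v. dist v u powr k) \<longlongrightarrow> 0) (at u within T)"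
    using k by (intro tendsto_zero_powrI[where b = k]) auto
  then have "((\<lambda>v. C * dist v u powr k) \<longlongrightarrow> 0) (at u within T)"
    by (rule tendsto_mult_right_zero)
  then have "((\<lambda>v. f v - f u) \<longlongrightarrow> 0) (at u within T)"
    by (rule Lim_null_comparison[rotated]) (use f u in \<open>auto simp: eventually_at_filter\<close>)
  then show "(f \<longlongrightarrow> f u) (at u within T)"
    by (simp add: LIM_zero_iff)
qed

section \<open>Sample path regularity on the sphere\<close>

text \<open>The bound is uniform, so the whole sphere serves as the neighbourhood of each of its points.
The absolute value of \<open>C\<close> makes the bound visibly increasing in the distance.\<close>

lemma holder_imp_locally_sample_holder:
  fixes Y :: "real ^ 'n \<Rightarrow> 'w \<Rightarrow> real"
  assumes k: "k > 0"
    and holder: "AE \<omega> in M. \<exists>C. \<forall>u\<in>unit_sphere. \<forall>v\<in>unit_sphere.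
      \<bar>Y u \<omega> - Y v \<omega>\<bar> \<le> C * dist u v powr k"
  shows "as_locally_sample_holder M Y k"
  unfolding as_locally_sample_holder_def using holder
proof eventually_elim
  case (elim \<omega>)
  then obtain C where C: "\<And>u v. norm u = 1 \<Longrightarrow> norm v = 1 \<Longrightarrow>
      \<bar>Y u \<omega> - Y v \<omega>\<bar> \<le> C * dist u v powr k"
    by (metis mem_sphere_0)
  have "\<bar>(Y u \<omega> - Y v \<omega>) / geodesic_dist u v powr k\<bar> \<le> \<bar>C\<bar>"
    if uv: "norm u = 1" "norm v = 1" "u \<noteq> v" for u v
  proof -
    have le: "dist u v \<le> geodesic_dist u v"
      using norm_diff_le_geodesic_dist[OF uv(1,2)] by (simp add: dist_norm)
    have "0 < dist u v" using uv(3) by simp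
    with le have pos: "0 < geodesic_dist u v" by linarith
    have "\<bar>Y u \<omega> - Y v \<omega>\<bar> \<le> C * dist u v powr k"
      by (rule C[OF uv(1,2)])
    also have "\<dots> \<le> \<bar>C\<bar> * geodesic_dist u v powr k"
      using le k by (intro mult_mono powr_mono2) auto
    finally show ?thesis
      using pos by (simp add: abs_divide divide_le_eq)
  qed
  then show ?case
    by (intro ballI exI[of _ unit_sphere] exI[of _ "\<bar>C\<bar>"]) auto
qed

theorem proposition3:
  fixes d :: nat
    and M :: "'w measure"
    and Y :: "real ^ 'n \<Rightarrow> 'w \<Rightarrow> real"
  assumes "d \<ge> 1" and "CARD('n) = d + 1"
    and "gaussian_field_on unit_sphere M Y"
    and "mean_zero_on unit_sphere M Y"
    and "has_multiquadric_covariance M Y"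
  shows "(\<exists>Z. modification_on unit_sphere M Y Z \<and>
              (\<forall>k\<in>{0<..<1}. as_locally_sample_holder M Z k)) \<and>
         (separable_field_on unit_sphere M Y \<longrightarrow>
              (\<forall>k\<in>{0<..<1}. as_locally_sample_holder M Y k))"
proof -
  obtain Z where mod: "modification_on unit_sphere M Y Z"
    and Z: "\<And>k. k \<in> {0<..<1} \<Longrightarrow> AE \<omega> in M. \<exists>C. \<forall>u\<in>unit_sphere. \<forall>v\<in>unit_sphere.
      \<bar>Z u \<omega> - Z v \<omega>\<bar> \<le> C * dist u v powr k"
    using kolmogorov_chentsov_all_moments[OF _ _ multiquadric_field_moments[OF assms(3-5)]] assms(3)
    by (auto simp: gaussian_field_on_def)
  have Y: "as_locally_sample_holder M Y k"
    if sep: "separable_field_on unit_sphere M Y" and k: "k \<in> {0<..<1}" for k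
  proof -
    have "AE \<omega> in M. continuous_on unit_sphere (\<lambda>u. Z u \<omega>)"
      using Z[OF k]
    proof eventually_elim
      case (elim \<omega>)
      with k show ?case
        by (auto intro: holder_imp_continuous_on[of k])
    qed
    with sep mod have "AE \<omega> in M. \<forall>u\<in>unit_sphere. Y u \<omega> = Z u \<omega>"
      by (rule separable_eq_continuous_modification)
    with Z[OF k] have "AE \<omega> in M. \<exists>C. \<forall>u\<in>unit_sphere. \<forall>v\<in>unit_sphere.
        \<bar>Y u \<omega> - Y v \<omega>\<bar> \<le> C * dist u v powr k"
      by eventually_elim simp
    with k show ?thesis by (intro holder_imp_locally_sample_holder) auto
  qed
  show ?thesis
    using mod Z Y by (auto intro!: exI[of _ Z] holder_imp_locally_sample_holder)
qed

end
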